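(* Let $f\in\mathcal F$ be a base classifier, $g=f\star\mu$ with $\mu$ the isotropic Gaussian distribution $\mathcal N(0,\sigma^2 I)$ on $\mathbb R^d$, $y^{(0)}=g(x)$ and $y^{(1)}=\nabla g(x)$. Then for any unit vector $v$ and any positive value of $r$, $\mathbf p_x(x+\sigma r v)$ can be lower bounded by solving the following set of equations for $(c_0,c_1,c_2)$: $$(A)\ \int_{-\infty}^{\infty}\tfrac{1}{\sqrt{2\pi}}e^{-t^2/2}\,\Phi(c(t))\,dt=q,$$ $$(B)\ \int_{-\infty}^{\infty}\tfrac{1}{\sqrt{2\pi}}e^{-t^2/2}\,\tfrac{1}{\sqrt{2\pi}}e^{-c(t)^2/2}\,dt=m_2,\qquad (C)\ \int_{-\infty}^{\infty}\tfrac{1}{\sqrt{2\pi}}\,t\,e^{-t^2/2}\,\Phi(c(t))\,dt=m_1,$$ with $q\le y^{(0)}$, $m_1\le\sigma v^Ty^{(1)}$, $m_2\le\sigma\|y^{(1)}-(v^Ty^{(1)})v\|_2$, and $c(t):=c_0+c_1t+c_2e^{rt}$. If the solution $(c_0,c_1,c_2)$ of these equations has $c_1<0$, then the lower bound of $\mathbf p_x(x+\sigma r v)$ is instead given by solving only (A) and (B) with $c(t):=c_0+c_2e^{rt}$.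
   Context: $\mathcal Y$ is the finite set of classes, $\Delta^{\mathcal Y}$ the probability simplex over $\mathcal Y$, and $\mathcal F$ the set of all classifiers $f:\mathbb R^d\to\Delta^{\mathcal Y}$. $(f\star\mu)(x)=\int_{\mathbb R^d}f(x+z)\mu(z)\,dz$ and $\mathcal G^\mu_{\mathcal F}=\{f\star\mu:f\in\mathcal F\}$. The class predicted at $x$ is fixed; $h(z)_c$ is the component of $h(z)$ for that class, and $y^{(0)}$, $y^{(1)}$ (and $h(x)$, $\nabla h(x)$ below) are understood for that component. The first-order lower-bound probability function is $$\mathbf p_x(z)=\min\{h(z)_c:\ h\in\mathcal G^\mu_{\mathcal F},\ h(x)=y^{(0)},\ \nabla h(x)=y^{(1)}\}.$$ $\Phi$ is the CDF of the standard normal distribution. The lower bound obtained "by solving" the equations is the value $\int_{-\infty}^{\infty}\tfrac{1}{\sqrt{2\pi}}e^{-(t-r)^2/2}\,\Phi(c(t))\,dt$ for the function $c$ found.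
   Formalization: As stated the claim fails for some solutions; the formal version adds that the solution used has c_2 ≤ 0 (with c_2 > 0 it can give an upper bound) and that c_0 ≥ 0 or q = y^(0), both also for the solution of (A),(B) when c_1 < 0; the original solution has c_2 ≤ 0 there too. *)

theory Defs
  imports "HOL-Probability.Probability"
begin

definition prob_simplex :: "(real^'y::finite) set" where
  "prob_simplex = {p. (\<forall>k. 0 \<le> p $ k) \<and> (\<Sum>k\<in>UNIV. p $ k) = 1}"

(* Measurability is what makes the smoothing integrals below well defined. *)
definition classifiers :: "(real^'d::finite \<Rightarrow> real^'y::finite) set" where
  "classifiers = {f. f \<in> borel_measurable lebesgue \<and> (\<forall>x. f x \<in> prob_simplex)}"

definition smooth ::
  "(real^'d::finite \<Rightarrow> real^'y::finite) \<Rightarrow> (real^'d \<Rightarrow> real) \<Rightarrow> real^'d \<Rightarrow> real^'y" where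
  "smooth f \<mu> x = (LINT z|lebesgue. \<mu> z *\<^sub>R f (x + z))"

definition smoothed_classifiers ::
  "(real^'d::finite \<Rightarrow> real) \<Rightarrow> (real^'d \<Rightarrow> real^'y::finite) set" where
  "smoothed_classifiers \<mu> = (\<lambda>f. smooth f \<mu>) ` classifiers"

definition gaussian_density :: "real \<Rightarrow> real^'d::finite \<Rightarrow> real" where
  "gaussian_density \<sigma> z =
     exp (- (norm z)\<^sup>2 / (2 * \<sigma>\<^sup>2)) / (sqrt (2 * pi * \<sigma>\<^sup>2)) ^ CARD('d)"

definition gradient :: "(real^'d::finite \<Rightarrow> real) \<Rightarrow> real^'d \<Rightarrow> real^'d" where
  "gradient F x = (THE D. GDERIV F x :> D)"

(* The minimum is rendered as Inf. The set is bounded below by 0, and it is nonempty when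
   y0 and y1 are the value and the gradient at x of component k of some smoothed classifier. *)
definition lower_prob ::
  "(real^'d::finite \<Rightarrow> real) \<Rightarrow> 'y::finite \<Rightarrow> real^'d \<Rightarrow> real \<Rightarrow> real^'d \<Rightarrow> real^'d \<Rightarrow> real" where
  "lower_prob \<mu> k x y0 y1 z =
     Inf {h z $ k | h. h \<in> smoothed_classifiers \<mu> \<and> h x $ k = y0 \<and>
                       gradient (\<lambda>u. h u $ k) x = y1}"

abbreviation std_normal_cdf :: "real \<Rightarrow> real" where
  "std_normal_cdf \<equiv> cdf std_normal_distribution"

(* Moments of the region {(t, s). s + c t >= 0} produced by the generalized Neyman-Pearson lemma,
   where t and s are independent standard normal coordinates along v and along the component of
   the gradient orthogonal to v: eq_A is its probability, eq_B and eq_C the integrals of s and t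
   over it. bound_value is its probability when the t coordinate is shifted by r. *)
definition eq_A :: "(real \<Rightarrow> real) \<Rightarrow> real \<Rightarrow> bool" where
  "eq_A c q \<longleftrightarrow> (LBINT t. std_normal_density t * std_normal_cdf (c t)) = q"

definition eq_B :: "(real \<Rightarrow> real) \<Rightarrow> real \<Rightarrow> bool" where
  "eq_B c m2 \<longleftrightarrow> (LBINT t. std_normal_density t * std_normal_density (c t)) = m2"

definition eq_C :: "(real \<Rightarrow> real) \<Rightarrow> real \<Rightarrow> bool" where
  "eq_C c m1 \<longleftrightarrow> (LBINT t. t * std_normal_density t * std_normal_cdf (c t)) = m1"

(* For c t = c0 + c1 * t + c2 * exp (r * t) the moments do not determine c: in general one solution
   has c2 < 0 and its region minimizes the shifted probability, another has c2 > 0 and its region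
   maximizes it. Lower bounds come from c2 <= 0. Likewise, replacing a moment by a smaller value
   keeps the lower bound only if the coefficient paired with it (c0 for q, c1 for m1) is >= 0. *)
definition bound_value :: "real \<Rightarrow> (real \<Rightarrow> real) \<Rightarrow> real" where
  "bound_value r c = (LBINT t. std_normal_density (t - r) * std_normal_cdf (c t))"

end

theory Submission
  imports Defs
begin

text \<open>In the coordinates \<open>z \<mapsto> x + \<sigma> z\<close> a competitor \<open>h\<close> is given by a function \<open>H\<close> with values in
  \<open>[0, 1]\<close>: for standard Gaussian \<open>z\<close> its value at \<open>x\<close> is the mean of \<open>H\<close>, \<open>\<sigma>\<close> times its gradient is
  the mean of \<open>H z\<close>, and its value at \<open>x + \<sigma> r v\<close> is the mean of
  \<open>H exp (r (v \<bullet> z) - r\<^sup>2 / 2)\<close>. With \<open>u\<close> the direction of the gradient component orthogonal to \<open>v\<close>,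
  the coordinates \<open>v \<bullet> z\<close> and \<open>u \<bullet> z\<close> are independent standard normal variables, so (A)-(C) are the
  moments of the region \<open>u \<bullet> z + c (v \<bullet> z) \<ge> 0\<close>, and the generalized Neyman-Pearson lemma shows
  that no \<open>H\<close> with at least these moments has a smaller shifted mean, provided the multipliers
  of (A) and (C) are nonnegative and \<open>c2\<close> is nonpositive. If \<open>c1 < 0\<close>, the multiplier
  of (C) is dropped. Equation (B) forces \<open>m2 > 0\<close>, so \<open>u\<close> exists.\<close>

subsection \<open>Invariance of Lebesgue measure under isometries\<close>

lemma nn_integral_lborel_translate:
  fixes f :: "'a::euclidean_space \<Rightarrow> ennreal"
  assumes [measurable]: "f \<in> borel_measurable borel"
  shows "(\<integral>\<^sup>+x. f (a + x) \<partial>lborel) = (\<integral>\<^sup>+x. f x \<partial>lborel)"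
proof -
  have "(\<integral>\<^sup>+x. f x \<partial>lborel) = (\<integral>\<^sup>+x. f x \<partial>distr lborel borel ((+) a))"
    by (simp add: lborel_distr_plus)
  then show ?thesis
    by (simp add: nn_integral_distr)
qed

lemma nn_integral_lborel_reflect:
  fixes f :: "'a::euclidean_space \<Rightarrow> ennreal"
  assumes [measurable]: "f \<in> borel_measurable borel"
  shows "(\<integral>\<^sup>+x. f (a - x) \<partial>lborel) = (\<integral>\<^sup>+x. f x \<partial>lborel)"
  by (subst (2) lborel_affine[of "-1" a]) (simp_all add: nn_integral_density nn_integral_distr)

lemma borel_measurable_orthogonal_transformation:
  fixes T :: "'a::euclidean_space \<Rightarrow> 'a"
  assumes "orthogonal_transformation T"
  shows "T \<in> borel \<rightarrow>\<^sub>M borel"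
  using assms by (auto simp: orthogonal_transformation_def linear_conv_bounded_linear
      intro!: borel_measurable_continuous_onI linear_continuous_on)

text \<open>The argument for uniqueness of Haar measure: Fubini's theorem and translation invariance
  identify the image measure with Lebesgue measure up to a factor, which the unit ball shows
  to be 1.\<close>

lemma distr_lborel_orthogonal_transformation:
  fixes T :: "'a::euclidean_space \<Rightarrow> 'a"
  assumes T: "orthogonal_transformation T"
  shows "distr lborel borel T = lborel"
proof (rule measure_eqI)
  fix A assume "A \<in> sets (distr lborel borel T)"
  then have [measurable]: "A \<in> sets borel" by simp
  have [measurable]: "T \<in> borel \<rightarrow>\<^sub>M borel"
    by (rule borel_measurable_orthogonal_transformation[OF T])
  define f :: "'a \<Rightarrow> ennreal" where "f = indicator A"
  have [measurable]: "f \<in> borel_measurable borel" by (simp add: f_def)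
  define S where "S = inv T"
  have S: "orthogonal_transformation S" unfolding S_def
    by (rule orthogonal_transformation_inv[OF T])
  have [measurable]: "S \<in> borel \<rightarrow>\<^sub>M borel"
    by (rule borel_measurable_orthogonal_transformation[OF S])
  have TS: "T (S y) = y" for y
    unfolding S_def using orthogonal_transformation_surj[OF T] by (simp add: surj_f_inv_f)
  define B :: "'a \<Rightarrow> ennreal" where "B = indicator (ball 0 1)"
  have [measurable]: "B \<in> borel_measurable borel" unfolding B_def by (intro borel_measurable_indicator) simp
  have T_add: "T (x + y) = T x + T y" and T_diff: "T (x - y) = T x - T y" for x y
    using orthogonal_transformation_linear[OF T] by (simp_all add: linear_add linear_diff)
  \<comment> \<open>\<open>T\<close> carries \<open>S y - x\<close> to \<open>y - T x\<close>, and
    membership in the unit ball depends on the norm alone. With the right-hand form, the inner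
    integral over \<open>x\<close> below is the volume of the ball for every
    \<open>y\<close>.\<close>
  have BT: "B (y - T x) = B (S y - x)" for x y
  proof -
    have "norm (y - T x) = norm (T (S y - x))" by (simp add: T_diff TS)
    then show ?thesis
      by (simp add: B_def indicator_def dist_norm norm_minus_commute orthogonal_transformation_norm[OF T])
  qed
  have "(\<integral>\<^sup>+x. f (T x) \<partial>lborel) * (\<integral>\<^sup>+y. B y \<partial>lborel)
      = (\<integral>\<^sup>+y. (\<integral>\<^sup>+x. f (T x) \<partial>lborel) * B y \<partial>lborel)"
    by (simp add: nn_integral_cmult)
  \<comment> \<open>Translating \<open>x\<close> by \<open>S y\<close> adds \<open>y\<close> to the
    argument of \<open>f\<close>. After the interchange, a translation in \<open>y\<close> moves the
    shift from \<open>f\<close> to \<open>B\<close>, and a second interchange separates the two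
    integrals.\<close>
  also have "\<dots> = (\<integral>\<^sup>+y. (\<integral>\<^sup>+x. f (T (S y + x)) \<partial>lborel) * B y \<partial>lborel)"
    by (subst nn_integral_lborel_translate[where f="\<lambda>x. f (T x)"]) simp_all
  also have "\<dots> = (\<integral>\<^sup>+y. \<integral>\<^sup>+x. f (y + T x) * B y \<partial>lborel \<partial>lborel)"
    by (simp add: nn_integral_multc T_add TS)
  also have "\<dots> = (\<integral>\<^sup>+x. \<integral>\<^sup>+y. f (y + T x) * B y \<partial>lborel \<partial>lborel)"
    by (rule lborel_pair.Fubini') measurable
  also have "\<dots> = (\<integral>\<^sup>+x. \<integral>\<^sup>+y. f y * B (y - T x) \<partial>lborel \<partial>lborel)"
  proof (rule nn_integral_cong)
    fix x
    show "(\<integral>\<^sup>+y. f (y + T x) * B y \<partial>lborel) = (\<integral>\<^sup>+y. f y * B (y - T x) \<partial>lborel)"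
      using nn_integral_lborel_translate[of "\<lambda>y. f y * B (y - T x)" "T x"]
      by (simp add: add.commute)
  qed
  also have "\<dots> = (\<integral>\<^sup>+y. \<integral>\<^sup>+x. f y * B (y - T x) \<partial>lborel \<partial>lborel)"
    by (rule lborel_pair.Fubini') measurable
  also have "\<dots> = (\<integral>\<^sup>+y. f y * (\<integral>\<^sup>+x. B (S y - x) \<partial>lborel) \<partial>lborel)"
    by (simp add: nn_integral_cmult BT)
  also have "\<dots> = (\<integral>\<^sup>+y. f y \<partial>lborel) * (\<integral>\<^sup>+y. B y \<partial>lborel)"
    by (simp add: nn_integral_lborel_reflect nn_integral_multc)
  finally have *: "(\<integral>\<^sup>+x. f (T x) \<partial>lborel) * (\<integral>\<^sup>+y. B y \<partial>lborel)
      = (\<integral>\<^sup>+y. f y \<partial>lborel) * (\<integral>\<^sup>+y. B y \<partial>lborel)" .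
  \<comment> \<open>Cancelling this factor in \<open>ennreal\<close> requires it to be finite and
    nonzero.\<close>
  have "(\<integral>\<^sup>+y. B y \<partial>lborel) = emeasure lborel (ball (0::'a) 1)"
    by (simp add: B_def)
  moreover have "emeasure lborel (ball (0::'a) 1) < \<infinity>"
    by (rule emeasure_bounded_finite) simp
  moreover have "emeasure lborel (ball (0::'a) 1) \<noteq> 0"
    using content_ball_pos[of 1 "0::'a"] by (auto simp: measure_def)
  ultimately have "(\<integral>\<^sup>+x. f (T x) \<partial>lborel) = (\<integral>\<^sup>+y. f y \<partial>lborel)"
    using * by (auto simp: mult.commute[of _ "emeasure lborel (ball 0 1)"] ennreal_mult_cancel_left)
  then have "(\<integral>\<^sup>+x. f x \<partial>distr lborel borel T) = (\<integral>\<^sup>+y. f y \<partial>lborel)"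
    by (simp add: nn_integral_distr)
  then show "emeasure (distr lborel borel T) A = emeasure lborel A"
    by (simp add: f_def)
qed simp

text \<open>The Householder reflection in the hyperplane orthogonal to \<open>a - b\<close>. That
  hyperplane consists of the vectors with equal inner products with \<open>a\<close> and
  \<open>b\<close>, which gives the last clause; it lets a second reflection be applied without
  disturbing a vector already placed.\<close>

lemma reflection_exists:
  fixes a b :: "'a::euclidean_space"
  assumes "norm a = norm b"
  obtains T :: "'a \<Rightarrow> 'a" where "orthogonal_transformation T" "T a = b" "\<And>c. c \<bullet> a = c \<bullet> b \<Longrightarrow> T c = c"
proof (cases "a = b")
  case True
  then show ?thesis using that[of "\<lambda>x. x"] by simp
next
  case False
  define w where "w = a - b"
  have w: "w \<bullet> w \<noteq> 0" using False by (simp add: w_def)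
  define T where "T x = x - (2 * (x \<bullet> w) / (w \<bullet> w)) *\<^sub>R w" for x
  have "linear T"
    by (rule linearI) (simp_all add: T_def inner_add_left algebra_simps add_divide_distrib)
  moreover have "T x \<bullet> T y = x \<bullet> y" for x y
  proof -
    define k where "k y = 2 * (y \<bullet> w) / (w \<bullet> w)" for y
    have k: "k y * (w \<bullet> w) = 2 * (y \<bullet> w)" for y using w by (simp add: k_def)
    have "k x * (y \<bullet> w) = k y * (x \<bullet> w)" by (simp add: k_def)
    moreover have "T x \<bullet> T y = x \<bullet> y - k y * (x \<bullet> w) - k x * (y \<bullet> w) + k x * (k y * (w \<bullet> w))"
      by (simp add: T_def k_def[symmetric] inner_diff_left inner_diff_right inner_commute[of w y]
          right_diff_distrib)
    ultimately show ?thesis by (simp add: k)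
  qed
  \<comment> \<open>Equality of the norms enters here: the coefficient of \<open>w\<close> in
    \<open>T a\<close> becomes 1, so \<open>T a = a - w = b\<close>.\<close>
  moreover have "2 * (a \<bullet> w) = w \<bullet> w"
    using assms by (simp add: w_def norm_eq inner_diff_left inner_diff_right inner_commute)
  then have "T a = b" using w by (simp add: T_def) (simp add: w_def)
  moreover have "T c = c" if "c \<bullet> a = c \<bullet> b" for c
    using that by (simp add: T_def w_def inner_diff_right)
  ultimately show ?thesis
    using that[of T] by (simp add: orthogonal_transformation_def)
qed

text \<open>Two reflections suffice. The first sends \<open>b\<close> to \<open>v\<close>; the
  second sends the image of \<open>b'\<close> to \<open>u\<close> and fixes \<open>v\<close>, since
  \<open>v\<close> is orthogonal to both of these vectors.\<close>

lemma orthogonal_transformation_to_orthonormal_pair: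
  fixes u v :: "'a::euclidean_space"
  assumes "norm u = 1" "norm v = 1" "v \<bullet> u = 0"
  obtains T :: "'a \<Rightarrow> 'a" and b b' where "orthogonal_transformation T" "b \<in> Basis" "b' \<in> Basis" "b \<noteq> b'"
    "T b = v" "T b' = u"
proof -
  \<comment> \<open>An orthonormal pair is independent, so the dimension is at least two and
    distinct basis vectors \<open>b\<close> and \<open>b'\<close> exist.\<close>
  have "u \<noteq> v" using assms by (auto simp: dot_square_norm)
  have "pairwise orthogonal {u, v}"
    using assms by (simp add: pairwise_insert orthogonal_def inner_commute)
  moreover have "0 \<notin> {u, v}" using assms by auto
  ultimately have "card {u, v} \<le> DIM('a)"
    using pairwise_orthogonal_independent independent_bound by blast
  then have "\<not> card (Basis :: 'a set) \<le> 1" using \<open>u \<noteq> v\<close> by simp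
  then obtain b b' :: 'a where b: "b \<in> Basis" "b' \<in> Basis" "b \<noteq> b'"
    using card_le_Suc0_iff_eq[of "Basis :: 'a set"] by auto
  obtain T1 :: "'a \<Rightarrow> 'a" where T1: "orthogonal_transformation T1" "T1 b = v"
    using reflection_exists[of b v] b assms by (metis norm_Basis)
  have "norm (T1 b') = norm u"
    using T1(1) b assms by (simp add: orthogonal_transformation_norm)
  then obtain T2 :: "'a \<Rightarrow> 'a" where T2: "orthogonal_transformation T2" "T2 (T1 b') = u"
      "\<And>c. c \<bullet> T1 b' = c \<bullet> u \<Longrightarrow> T2 c = c"
    using reflection_exists by metis
  have "v \<bullet> T1 b' = b \<bullet> b'"
    using T1 by (metis orthogonal_transformation_def)
  then have "T2 v = v" using T2(3)[of v] b assms by (simp add: inner_Basis)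
  then show ?thesis
    using that[of "T2 \<circ> T1" b b'] T1 T2 b orthogonal_transformation_compose by auto
qed

subsection \<open>The standard Gaussian measure\<close>

text \<open>Any Euclidean space is allowed, so that the input space \<open>real^'d\<close> is
  covered and also, through \<open>std_gaussian_real\<close>, the real line, which inherits its
  exponential integrability.\<close>

definition std_gaussian_density :: "'a::euclidean_space \<Rightarrow> real" where
  "std_gaussian_density z = exp (- (norm z)\<^sup>2 / 2) / sqrt (2 * pi) ^ DIM('a)"

definition std_gaussian :: "'a::euclidean_space measure" where
  "std_gaussian = density lborel (\<lambda>z. ennreal (std_gaussian_density z))"

lemma std_gaussian_density_nonneg [simp]: "0 \<le> std_gaussian_density z"
  by (simp add: std_gaussian_density_def)

lemma borel_measurable_std_gaussian_density [measurable]: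
  "std_gaussian_density \<in> borel_measurable borel"
  unfolding std_gaussian_density_def[abs_def] by measurable

lemma sets_std_gaussian [simp, measurable_cong]: "sets std_gaussian = sets borel"
  by (simp add: std_gaussian_def)

lemma space_std_gaussian [simp]: "space std_gaussian = UNIV"
  by (simp add: std_gaussian_def)

lemma std_gaussian_density_prod:
  fixes z :: "'a::euclidean_space"
  shows "std_gaussian_density z = (\<Prod>b\<in>Basis. std_normal_density (z \<bullet> b))"
proof -
  have "(norm z)\<^sup>2 = (\<Sum>b\<in>Basis. (z \<bullet> b)\<^sup>2)"
    by (subst power2_norm_eq_inner, subst euclidean_inner) (simp add: power2_eq_square)
  moreover have "(\<Prod>b\<in>Basis. std_normal_density (z \<bullet> b))
      = (1 / sqrt (2 * pi)) ^ DIM('a) * exp (\<Sum>b\<in>Basis. - (z \<bullet> b)\<^sup>2 / 2)"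
    by (simp only: std_normal_density_def prod.distrib prod_constant exp_sum[OF finite_Basis])
  moreover have "(\<Sum>b\<in>Basis. - (z \<bullet> b)\<^sup>2 / 2) = - (\<Sum>b\<in>Basis. (z \<bullet> b)\<^sup>2) / 2"
    by (simp only: sum_divide_distrib[symmetric] sum_negf)
  ultimately show ?thesis
    by (simp only: std_gaussian_density_def power_one_over mult_1_left times_divide_eq_left)
qed

text \<open>The density is a product over coordinates. Absorbing each indicator into the factor of
  its own coordinate keeps the integrand a product, and all factors other than those of
  \<open>b\<close> and \<open>b'\<close> integrate to 1.\<close>

lemma emeasure_std_gaussian_rectangle:
  assumes b: "b \<in> Basis" "b' \<in> Basis" "b \<noteq> (b'::'a::euclidean_space)"
    and [measurable]: "A \<in> sets borel" "B \<in> sets borel"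
  shows "emeasure std_gaussian {z::'a. b \<bullet> z \<in> A \<and> b' \<bullet> z \<in> B}
    = emeasure std_normal_distribution A * emeasure std_normal_distribution B"
proof -
  define g where "g c t = ennreal (std_normal_density t) *
     (if c = b then indicator A t else if c = b' then indicator B t else 1)" for c :: 'a and t
  have [measurable]: "g c \<in> borel_measurable borel" for c
    unfolding g_def by measurable
  have g: "ennreal (std_gaussian_density z) * indicator {z. b \<bullet> z \<in> A \<and> b' \<bullet> z \<in> B} z
      = (\<Prod>c\<in>Basis. g c (z \<bullet> c))" for z :: 'a
  proof -
    have "(\<Prod>c\<in>Basis. g c (z \<bullet> c)) = ennreal (std_gaussian_density z) *
       (\<Prod>c\<in>Basis. if c = b then indicator A (z \<bullet> c)
          else if c = b' then indicator B (z \<bullet> c) else 1)"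
      by (simp add: g_def prod.distrib std_gaussian_density_prod prod_ennreal)
    also have "(\<Prod>c\<in>Basis. if c = b then indicator A (z \<bullet> c) else
          if c = b' then indicator B (z \<bullet> c) else (1::ennreal))
       = (\<Prod>c\<in>{b,b'}. if c = b then indicator A (z \<bullet> c) else
          if c = b' then indicator B (z \<bullet> c) else 1)"
      using b by (intro prod.mono_neutral_right) auto
    also have "\<dots> = indicator {z. b \<bullet> z \<in> A \<and> b' \<bullet> z \<in> B} z"
      using b by (auto simp: inner_commute split: split_indicator)
    finally show ?thesis by simp
  qed
  have g_int: "(\<integral>\<^sup>+t. g c t \<partial>lborel) = (if c = b then emeasure std_normal_distribution A
     else if c = b' then emeasure std_normal_distribution B else 1)" for c
    using prob_space.emeasure_space_1[OF prob_space_normal_density[of 1 0]]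
    by (auto simp: g_def emeasure_density)
  have "emeasure std_gaussian {z. b \<bullet> z \<in> A \<and> b' \<bullet> z \<in> B}
     = (\<integral>\<^sup>+z. (\<Prod>c\<in>Basis. g c (z \<bullet> c)) \<partial>(lborel :: 'a measure))"
    by (simp add: std_gaussian_def emeasure_density g)
  also have "\<dots> = (\<Prod>c\<in>Basis. \<integral>\<^sup>+t. g c t \<partial>lborel)"
    by (rule nn_integral_lborel_prod) auto
  also have "\<dots> = (\<Prod>c\<in>{b,b'}. \<integral>\<^sup>+t. g c t \<partial>lborel)"
    using b by (intro prod.mono_neutral_right) (auto simp: g_int)
  also have "\<dots> = emeasure std_normal_distribution A * emeasure std_normal_distribution B"
    using b by (simp add: g_int)
  finally show ?thesis .
qed

lemma prob_space_std_gaussian: "prob_space std_gaussian"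
proof
  have "emeasure std_gaussian (UNIV :: 'a set)
    = (\<integral>\<^sup>+z. (\<Prod>c\<in>Basis. ennreal (std_normal_density (z \<bullet> c))) \<partial>(lborel :: 'a measure))"
    by (simp add: std_gaussian_def emeasure_density std_gaussian_density_prod prod_ennreal)
  also have "\<dots> = (\<Prod>c\<in>(Basis :: 'a set). \<integral>\<^sup>+t. ennreal (std_normal_density t) \<partial>lborel)"
    by (rule nn_integral_lborel_prod) auto
  also have "\<dots> = 1"
    using prob_space.emeasure_space_1[OF prob_space_normal_density[of 1 0]]
    by (simp add: emeasure_density)
  finally show "emeasure std_gaussian (space (std_gaussian :: 'a measure)) = 1" by simp
qed

interpretation std_gaussian: prob_space "std_gaussian :: 'a::euclidean_space measure"
  by (rule prob_space_std_gaussian)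

text \<open>Lebesgue measure is invariant under \<open>T\<close>, and the density depends only on
  the norm.\<close>

lemma distr_std_gaussian_orthogonal_transformation:
  fixes T :: "'a::euclidean_space \<Rightarrow> 'a"
  assumes T: "orthogonal_transformation T"
  shows "distr std_gaussian borel T = std_gaussian"
proof -
  have [measurable]: "T \<in> borel \<rightarrow>\<^sub>M borel"
    by (rule borel_measurable_orthogonal_transformation[OF T])
  have "distr (density lborel (\<lambda>z. ennreal (std_gaussian_density (T z)))) borel T
      = density (distr lborel borel T) (\<lambda>z. ennreal (std_gaussian_density z))"
    by (rule density_distr[symmetric]) auto
  moreover have "std_gaussian_density (T z) = std_gaussian_density z" for z
    using orthogonal_transformation_norm[OF T] by (simp add: std_gaussian_density_def)
  ultimately show ?thesis
    by (simp add: std_gaussian_def distr_lborel_orthogonal_transformation[OF T])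
qed

text \<open>Rotation invariance replaces \<open>v\<close> and \<open>u\<close> by two basis vectors,
  where the rectangle formula applies; rectangles determine a product measure. This independence
  reduces the moments of planar regions to iterated integrals.\<close>

lemma distr_std_gaussian_orthonormal_pair:
  fixes u v :: "'a::euclidean_space"
  assumes "norm u = 1" "norm v = 1" "v \<bullet> u = 0"
  shows "distr std_gaussian (std_normal_distribution \<Otimes>\<^sub>M std_normal_distribution)
      (\<lambda>z. (v \<bullet> z, u \<bullet> z)) = std_normal_distribution \<Otimes>\<^sub>M std_normal_distribution"
proof -
  obtain T :: "'a \<Rightarrow> 'a" and b b' where T: "orthogonal_transformation T"
    and b: "b \<in> Basis" "b' \<in> Basis" "b \<noteq> b'" "T b = v" "T b' = u"
    using orthogonal_transformation_to_orthonormal_pair[OF assms] .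
  have [measurable]: "T \<in> borel \<rightarrow>\<^sub>M borel"
    by (rule borel_measurable_orthogonal_transformation[OF T])
  have [simp]: "v \<bullet> T z = b \<bullet> z" "u \<bullet> T z = b' \<bullet> z" for z
    using T b unfolding orthogonal_transformation_def by metis+
  interpret N: prob_space std_normal_distribution
    by (rule prob_space_normal_density) simp
  show ?thesis
  proof (rule pair_measure_eqI[symmetric])
    fix A B assume "A \<in> sets std_normal_distribution" "B \<in> sets std_normal_distribution"
    then have [measurable]: "A \<in> sets borel" "B \<in> sets borel" by simp_all
    have "emeasure (distr std_gaussian (std_normal_distribution \<Otimes>\<^sub>M std_normal_distribution)
        (\<lambda>z. (v \<bullet> z, u \<bullet> z))) (A \<times> B) = emeasure std_gaussian {z. v \<bullet> z \<in> A \<and> u \<bullet> z \<in> B}"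
      by (subst emeasure_distr) (auto intro!: arg_cong2[where f=emeasure])
    also have "\<dots> = emeasure (distr std_gaussian borel T) {z. v \<bullet> z \<in> A \<and> u \<bullet> z \<in> B}"
      by (simp add: distr_std_gaussian_orthogonal_transformation[OF T])
    also have "\<dots> = emeasure std_gaussian {z. b \<bullet> z \<in> A \<and> b' \<bullet> z \<in> B}"
      by (subst emeasure_distr) (auto intro!: arg_cong2[where f=emeasure])
    finally show "emeasure std_normal_distribution A * emeasure std_normal_distribution B
      = emeasure (distr std_gaussian (std_normal_distribution \<Otimes>\<^sub>M std_normal_distribution)
        (\<lambda>z. (v \<bullet> z, u \<bullet> z))) (A \<times> B)"
      using emeasure_std_gaussian_rectangle[OF b(1-3)] by simp
  qed (auto intro: N.sigma_finite_measure_axioms)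
qed

section \<open>Exponential moments and differentiation of Gaussian translates\<close>

lemma std_gaussian_density_diff:
  fixes z w :: "'a::euclidean_space"
  shows "std_gaussian_density (z - w) = std_gaussian_density z * exp (w \<bullet> z - (norm w)\<^sup>2 / 2)"
proof -
  have "- (norm (z - w))\<^sup>2 / 2 = - (norm z)\<^sup>2 / 2 + (w \<bullet> z - (norm w)\<^sup>2 / 2)"
    by (simp add: power2_norm_eq_inner inner_diff_left inner_diff_right inner_commute field_simps)
  then show ?thesis
    by (simp only: std_gaussian_density_def exp_add times_divide_eq_left)
qed

text \<open>The weight \<open>exp (w \<bullet> z - (norm w)\<^sup>2 / 2)\<close> turns the Gaussian
  density into its translate by \<open>w\<close>, which again has total mass 1; the constant factor
  is then moved to the other side.\<close>

lemma has_bochner_integral_std_gaussian_exp: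
  fixes w :: "'a::euclidean_space"
  shows "has_bochner_integral std_gaussian (\<lambda>z. exp (w \<bullet> z)) (exp ((norm w)\<^sup>2 / 2))"
proof -
  have "(\<integral>\<^sup>+z. ennreal (exp (w \<bullet> z - (norm w)\<^sup>2 / 2)) \<partial>std_gaussian)
      = (\<integral>\<^sup>+z. ennreal (std_gaussian_density (- w + z)) \<partial>(lborel :: 'a measure))"
    by (simp add: std_gaussian_def nn_integral_density std_gaussian_density_diff ennreal_mult)
  also have "\<dots> = (\<integral>\<^sup>+z. ennreal (std_gaussian_density z) \<partial>(lborel :: 'a measure))"
    by (rule nn_integral_lborel_translate) simp
  also have "\<dots> = 1"
    using std_gaussian.emeasure_space_1 by (simp add: std_gaussian_def emeasure_density)
  finally have "has_bochner_integral std_gaussian (\<lambda>z. exp (w \<bullet> z - (norm w)\<^sup>2 / 2)) 1"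
    by (intro has_bochner_integral_nn_integral) auto
  then have "has_bochner_integral std_gaussian
      (\<lambda>z. exp (w \<bullet> z - (norm w)\<^sup>2 / 2) * exp ((norm w)\<^sup>2 / 2)) (1 * exp ((norm w)\<^sup>2 / 2))"
    by (intro has_bochner_integral_mult_left)
  then show ?thesis
    by (simp add: exp_add[symmetric])
qed

lemma integrable_std_gaussian_exp: "integrable std_gaussian (\<lambda>z. exp (w \<bullet> z))"
  using has_bochner_integral_std_gaussian_exp by (rule integrable.intros)

lemma integrable_std_gaussian_inner: "integrable std_gaussian (\<lambda>z. w \<bullet> z)"
proof (rule Bochner_Integration.integrable_bound)
  show "integrable std_gaussian (\<lambda>z. exp (w \<bullet> z) + exp ((- w) \<bullet> z))"
    by (intro Bochner_Integration.integrable_add integrable_std_gaussian_exp)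
  have "\<bar>x\<bar> \<le> exp x + exp (- x)" for x :: real
    using exp_ge_add_one_self[of x] exp_ge_add_one_self[of "- x"] exp_gt_zero[of x]
      exp_gt_zero[of "- x"] by linarith
  then show "AE z in std_gaussian. norm (w \<bullet> z) \<le> norm (exp (w \<bullet> z) + exp ((- w) \<bullet> z))"
    by (intro AE_I2) simp
qed simp

lemma integrable_std_gaussian_id: "integrable std_gaussian (\<lambda>z::'a::euclidean_space. z)"
proof -
  have "integrable std_gaussian (\<lambda>z::'a. \<Sum>b\<in>Basis. (b \<bullet> z) *\<^sub>R b)"
    by (intro Bochner_Integration.integrable_sum integrable_scaleR_left integrable_std_gaussian_inner)
  then show ?thesis
    by (simp add: inner_commute euclidean_representation)
qed

text \<open>Taylor's formula of order two for \<open>exp\<close>. The factor multiplying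
  \<open>s\<^sup>2\<close> does not depend on \<open>s\<close> and is integrable when
  \<open>n\<close> is a Gaussian coordinate, so integration leaves a quadratic error.\<close>

lemma exp_shift_second_order_bound:
  fixes n s :: real
  assumes "0 \<le> s" "s \<le> 1"
  shows "\<bar>exp (s * n - s\<^sup>2 / 2) - 1 - s * n\<bar> \<le> s\<^sup>2 * (1 / 2 + exp 2 * (exp (2 * n) + exp (- 2 * n)))"
proof -
  define a where "a = s * n - s\<^sup>2 / 2"
  \<comment> \<open>For \<open>0 \<le> s \<le> 1\<close> the exponent satisfies
    \<open>\<bar>a\<bar> \<le> s * b\<close>. Hence \<open>b\<close> bounds the intermediate point
    \<open>t\<close>, while the square of \<open>b\<close> is absorbed by
    \<open>2 * exp b\<close>.\<close>
  define b where "b = \<bar>n\<bar> + 1"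
  obtain t where t: "\<bar>t\<bar> \<le> \<bar>a\<bar>" "exp a = (\<Sum>m<2. a ^ m / fact m) + exp t / fact 2 * a ^ 2"
    using Maclaurin_exp_le by blast
  have "s\<^sup>2 \<le> s * 1" unfolding power2_eq_square using assms by (intro mult_left_mono) auto
  moreover have "\<bar>s * n\<bar> = s * \<bar>n\<bar>" using assms by (simp add: abs_mult)
  ultimately have a: "\<bar>a\<bar> \<le> s * b"
    unfolding a_def b_def using assms zero_le_power2[of s] abs_le_iff[of "s * n" "s * \<bar>n\<bar>"]
    by (simp only: distrib_left abs_le_iff) linarith
  also have "\<dots> \<le> 1 * b" using assms by (intro mult_right_mono) (auto simp: b_def)
  finally have "t \<le> b" using t(1) by simp
  have "a\<^sup>2 \<le> (s * b)\<^sup>2" using a power_mono[of "\<bar>a\<bar>" "s * b" 2] by simp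
  moreover have "b\<^sup>2 \<le> 2 * exp b"
    using exp_lower_Taylor_quadratic[of b] by (simp add: b_def)
  ultimately have a2: "a\<^sup>2 \<le> s\<^sup>2 * (2 * exp b)"
    by (smt (verit) mult_left_mono power_mult_distrib zero_le_power2)
  have "exp t * a\<^sup>2 \<le> exp b * (s\<^sup>2 * (2 * exp b))"
    using \<open>t \<le> b\<close> a2 by (intro mult_mono) auto
  also have "\<dots> = s\<^sup>2 * 2 * exp (2 * b)" by (simp add: exp_double power2_eq_square)
  also have "exp (2 * b) = exp 2 * exp (2 * \<bar>n\<bar>)" by (simp add: b_def exp_add[symmetric])
  also have "exp (2 * \<bar>n\<bar>) \<le> exp (2 * n) + exp (- 2 * n)" by (cases "n \<ge> 0") auto
  finally have "exp t * a\<^sup>2 \<le> s\<^sup>2 * 2 * (exp 2 * (exp (2 * n) + exp (- 2 * n)))" (is "_ \<le> _ * ?K")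
    by (simp add: mult_left_mono)
  moreover have "exp a - 1 - s * n = - (s\<^sup>2 / 2) + exp t * a\<^sup>2 / 2"
    using t(2) by (simp add: a_def numeral_2_eq_2)
  moreover have "0 \<le> exp t * a\<^sup>2" "0 \<le> s\<^sup>2" by simp_all
  moreover have "s\<^sup>2 * (1 / 2 + ?K) = s\<^sup>2 / 2 + s\<^sup>2 * 2 * ?K / 2"
    by (simp only: distrib_left) simp
  ultimately show ?thesis
    unfolding a_def[symmetric] abs_le_iff by linarith
qed

lemma integrable_scaleR_bounded:
  fixes f :: "'a \<Rightarrow> 'b::{banach, second_countable_topology}"
  assumes f: "integrable M f" and H: "H \<in> borel_measurable M" "\<And>x. \<bar>H x\<bar> \<le> 1"
  shows "integrable M (\<lambda>x. H x *\<^sub>R f x)"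
  using f
proof (rule Bochner_Integration.integrable_bound)
  show "AE x in M. norm (H x *\<^sub>R f x) \<le> norm (f x)"
    using H(2) by (intro AE_I2) (simp add: mult_left_le_one_le)
qed (use H(1) borel_measurable_integrable[OF f] in simp)

text \<open>The shift \<open>w\<close> enters only through the Gaussian weight, so no regularity of
  \<open>H\<close> beyond measurability and boundedness is involved. Integrating the second-order
  bound on the weight shows that the error of the linear approximation is at most a multiple of the
  squared norm of \<open>w\<close>.\<close>

lemma GDERIV_std_gaussian_translate:
  fixes H :: "'a::euclidean_space \<Rightarrow> real"
  assumes [measurable]: "H \<in> borel_measurable borel" and H: "\<And>z. \<bar>H z\<bar> \<le> 1"
  defines "P \<equiv> \<lambda>w. \<integral>z. H z * exp (w \<bullet> z - (norm w)\<^sup>2 / 2) \<partial>std_gaussian"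
  shows "GDERIV P 0 :> (\<integral>z. H z *\<^sub>R z \<partial>std_gaussian)"
proof -
  define D where "D = (\<integral>z. H z *\<^sub>R z \<partial>std_gaussian)"
  have H_meas: "H \<in> borel_measurable std_gaussian" by simp
  have mult: "integrable std_gaussian (\<lambda>z. H z * f z)" if "integrable std_gaussian f" for f
    using integrable_scaleR_bounded[OF that H_meas H] by simp
  have int_id: "integrable std_gaussian (\<lambda>z. H z *\<^sub>R z)"
    by (rule integrable_scaleR_bounded[OF integrable_std_gaussian_id H_meas H])
  have int_exp: "integrable std_gaussian (\<lambda>z. exp (w \<bullet> z - (norm w)\<^sup>2 / 2))" for w :: 'a
  proof -
    have "integrable std_gaussian (\<lambda>z. exp (w \<bullet> z) * exp (- (norm w)\<^sup>2 / 2))"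
      by (intro integrable_mult_left integrable_std_gaussian_exp)
    then show ?thesis by (simp add: exp_add[symmetric])
  qed
  have D: "w \<bullet> D = (\<integral>z. H z * (w \<bullet> z) \<partial>std_gaussian)" for w
    unfolding D_def using int_id by (simp flip: integral_inner_right)
  \<comment> \<open>The mean of the dominating function: for a unit vector \<open>e\<close>, each of
    \<open>exp (2 * (e \<bullet> z))\<close> and \<open>exp (- 2 * (e \<bullet> z))\<close> has mean
    \<open>exp 2\<close>.\<close>
  define M :: real where "M = 1 / 2 + 2 * exp 4"
  have "M > 0" unfolding M_def by (intro add_pos_pos) auto
  have bound: "\<bar>P w - P 0 - w \<bullet> D\<bar> \<le> (norm w)\<^sup>2 * M" if "w \<noteq> 0" "norm w \<le> 1" for w
  proof -
    \<comment> \<open>The scalar bound is applied with \<open>s = norm w\<close> and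
      \<open>n = e \<bullet> z\<close>.\<close>
    define e where "e = w /\<^sub>R norm w"
    have "norm e = 1" and we: "w = norm w *\<^sub>R e" using that by (simp_all add: e_def)
    have *: "P w - P 0 - w \<bullet> D
        = (\<integral>z. H z * (exp (w \<bullet> z - (norm w)\<^sup>2 / 2) - 1 - w \<bullet> z) \<partial>std_gaussian)"
      using mult[OF int_exp, of w] mult[OF integrable_std_gaussian_inner, of w]
        mult[of "\<lambda>_. 1"]
      by (simp add: P_def D right_diff_distrib)
    have "\<bar>P w - P 0 - w \<bullet> D\<bar> \<le>
       (\<integral>z. (norm w)\<^sup>2 * (1 / 2 + exp 2 * (exp ((2 *\<^sub>R e) \<bullet> z) + exp (((-2) *\<^sub>R e) \<bullet> z))) \<partial>std_gaussian)"
      unfolding *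
    proof (rule order_trans[OF integral_abs_bound integral_mono])
      show "integrable std_gaussian (\<lambda>z. \<bar>H z * (exp (w \<bullet> z - (norm w)\<^sup>2 / 2) - 1 - w \<bullet> z)\<bar>)"
        by (intro integrable_abs mult Bochner_Integration.integrable_diff int_exp
            integrable_std_gaussian_inner) simp
      show "integrable std_gaussian (\<lambda>z. (norm w)\<^sup>2 *
          (1 / 2 + exp 2 * (exp ((2 *\<^sub>R e) \<bullet> z) + exp (((-2) *\<^sub>R e) \<bullet> z))))"
        by (intro integrable_mult_right Bochner_Integration.integrable_add
            integrable_std_gaussian_exp) simp
      fix z
      have "\<bar>H z * (exp (w \<bullet> z - (norm w)\<^sup>2 / 2) - 1 - w \<bullet> z)\<bar>
          \<le> \<bar>exp (w \<bullet> z - (norm w)\<^sup>2 / 2) - 1 - w \<bullet> z\<bar>"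
        using H[of z] by (simp add: abs_mult mult_left_le_one_le)
      also have "\<dots> \<le> (norm w)\<^sup>2 * (1 / 2 + exp 2 * (exp (2 * (e \<bullet> z)) + exp (- 2 * (e \<bullet> z))))"
        using exp_shift_second_order_bound[of "norm w" "e \<bullet> z"] that we
        by (metis inner_scaleR_left norm_ge_zero)
      finally show "\<bar>H z * (exp (w \<bullet> z - (norm w)\<^sup>2 / 2) - 1 - w \<bullet> z)\<bar> \<le> (norm w)\<^sup>2 *
          (1 / 2 + exp 2 * (exp ((2 *\<^sub>R e) \<bullet> z) + exp (((-2) *\<^sub>R e) \<bullet> z)))"
        by simp
    qed
    also have "\<dots> = (norm w)\<^sup>2 * (1 / 2 + exp 2 * (exp 2 + exp 2))"
      using has_bochner_integral_integral_eq[OF has_bochner_integral_std_gaussian_exp, of "2 *\<^sub>R e"]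
        has_bochner_integral_integral_eq[OF has_bochner_integral_std_gaussian_exp, of "(-2) *\<^sub>R e"]
        \<open>norm e = 1\<close> integrable_std_gaussian_exp[of "2 *\<^sub>R e"] integrable_std_gaussian_exp[of "(-2) *\<^sub>R e"]
      by (simp add: std_gaussian.prob_space[simplified])
    also have "\<dots> = (norm w)\<^sup>2 * M" by (simp add: M_def exp_add[symmetric] distrib_left)
    finally show ?thesis .
  qed
  have "(P has_derivative (\<lambda>w. w \<bullet> D)) (at 0)"
    unfolding has_derivative_at'
  proof (intro conjI allI impI)
    fix \<epsilon> :: real assume "\<epsilon> > 0"
    show "\<exists>d>0. \<forall>x'. 0 < norm (x' - 0) \<and> norm (x' - 0) < d \<longrightarrow>
        norm (P x' - P 0 - (x' - 0) \<bullet> D) / norm (x' - 0) < \<epsilon>"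
    proof (intro exI[of _ "min 1 (\<epsilon> / M)"] conjI allI impI)
      fix w :: 'a assume w: "0 < norm (w - 0) \<and> norm (w - 0) < min 1 (\<epsilon> / M)"
      then have "norm w * M < \<epsilon>" using \<open>M > 0\<close> by (simp add: pos_less_divide_eq)
      moreover have "\<bar>P w - P 0 - w \<bullet> D\<bar> / norm w \<le> norm w * M"
        using bound[of w] w by (simp add: pos_divide_le_eq power2_eq_square mult_ac)
      ultimately show "norm (P w - P 0 - (w - 0) \<bullet> D) / norm (w - 0) < \<epsilon>" by simp
    qed (use \<open>\<epsilon> > 0\<close> \<open>M > 0\<close> in simp)
  qed (rule bounded_linear_inner_left)
  then show ?thesis
    by (simp add: gderiv_def D_def)
qed

subsection \<open>Moments of Gaussian half-regions\<close>

interpretation std_normal: prob_space std_normal_distribution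
  by (rule prob_space_normal_density) simp

lemma integral_std_normal_distribution:
  fixes f :: "real \<Rightarrow> real"
  assumes "f \<in> borel_measurable borel"
  shows "(\<integral>t. f t \<partial>std_normal_distribution) = (LBINT t. std_normal_density t * f t)"
  using assms by (subst integral_density) simp_all

lemma integrable_std_normal_distribution:
  fixes f :: "real \<Rightarrow> real"
  assumes "f \<in> borel_measurable borel"
  shows "integrable std_normal_distribution f \<longleftrightarrow> integrable lborel (\<lambda>t. std_normal_density t * f t)"
  using assms by (subst integrable_density) simp_all

text \<open>By symmetry of the density. The half-line on the right is the slice
  \<open>0 \<le> s + c\<close> of the regions studied below.\<close>

lemma std_normal_cdf_eq_measure_atLeast:
  "std_normal_cdf c = measure std_normal_distribution {- c..}"
proof -
  have "std_normal_cdf c = (\<integral>t. indicator {..c} t \<partial>std_normal_distribution)"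
    by (simp add: cdf_def)
  also have "\<dots> = (LBINT t. std_normal_density t * indicator {..c} t)"
    by (rule integral_std_normal_distribution) simp
  also have "\<dots> = (LBINT t. std_normal_density (- t) * indicator {..c} (- t))"
    using lborel_integral_real_affine[of "-1" "\<lambda>t. std_normal_density t * indicator {..c} t" 0]
    by simp
  also have "\<dots> = (LBINT t. std_normal_density t * indicator {- c..} t)"
    by (intro Bochner_Integration.integral_cong)
      (auto simp: std_normal_density_def split: split_indicator)
  also have "\<dots> = (\<integral>t. indicator {- c..} t \<partial>std_normal_distribution)"
    by (rule integral_std_normal_distribution[symmetric]) simp
  finally show ?thesis by simp
qed

text \<open>The negative of the density is an antiderivative of
  \<open>s * std_normal_density s\<close>, and it vanishes at infinity.\<close>

lemma integral_std_normal_id_atLeast: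
  "(\<integral>s. indicator {- c..} s * s \<partial>std_normal_distribution) = std_normal_density c"
proof -
  have int: "set_integrable lborel (einterval (ereal (- c)) \<infinity>) (\<lambda>s. s * std_normal_density s)"
    unfolding set_integrable_def
    using integrable_mult_indicator[OF _ integrable_std_normal_moment[of 1], of "{- c<..}"]
    by (simp add: mult.commute)
  have "(LBINT s=ereal (- c)..\<infinity>. s * std_normal_density s) = 0 - (- std_normal_density (- c))"
  proof (rule interval_integral_FTC_integrable[where F="\<lambda>s. - std_normal_density s"])
    show "((\<lambda>s. - std_normal_density s) has_vector_derivative x * std_normal_density x) (at x)" for x
      unfolding std_normal_density_def has_real_derivative_iff_has_vector_derivative[symmetric]
      by (auto intro!: derivative_eq_intros simp: field_simps)
    show "isCont (\<lambda>s. s * std_normal_density s) x" for x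
      unfolding std_normal_density_def by (intro continuous_intros) auto
    have "((\<lambda>s. - std_normal_density s) \<longlongrightarrow> - std_normal_density (- c)) (at_right (- c))"
      unfolding std_normal_density_def by (intro tendsto_intros) auto
    then show "(((\<lambda>s. - std_normal_density s) \<circ> real_of_ereal) \<longlongrightarrow> - std_normal_density (- c))
        (at_right (ereal (- c)))"
      by (simp only: ereal_tendsto_simps)
    have "((\<lambda>s. - std_normal_density s) \<longlongrightarrow> 0) at_top"
      unfolding std_normal_density_def by real_asymp
    then show "(((\<lambda>s. - std_normal_density s) \<circ> real_of_ereal) \<longlongrightarrow> 0) (at_left \<infinity>)"
      by (simp only: ereal_tendsto_simps)
    show "ereal (- c) < \<infinity>" by simp
  qed (rule int)
  moreover have "(LBINT s=ereal (- c)..\<infinity>. s * std_normal_density s)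
      = (LBINT s. indicator {- c<..} s * (s * std_normal_density s))"
    by (simp add: interval_lebesgue_integral_def set_lebesgue_integral_def)
  \<comment> \<open>The interval integral runs over the open half-line; its endpoint is a null
    set.\<close>
  moreover have "\<dots> = (LBINT s. std_normal_density s * (indicator {- c..} s * s))"
  proof (rule integral_cong_AE)
    show "AE s in lborel. indicator {- c<..} s * (s * std_normal_density s)
        = std_normal_density s * (indicator {- c..} s * s)"
      using AE_lborel_singleton[of "- c"] by eventually_elim (auto simp: indicator_def)
  qed simp_all
  moreover have "\<dots> = (\<integral>s. indicator {- c..} s * s \<partial>std_normal_distribution)"
    by (rule integral_std_normal_distribution[symmetric]) simp
  moreover have "std_normal_density (- c) = std_normal_density c"
    by (simp add: std_normal_density_def)
  ultimately show ?thesis by linarith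
qed

lemma borel_measurable_std_normal_cdf [measurable]: "std_normal_cdf \<in> borel_measurable borel"
  by (intro borel_measurable_mono monoI finite_borel_measure.cdf_nondecreasing)
    (simp_all add: finite_borel_measure_def finite_borel_measure_axioms_def
      std_normal.finite_measure_axioms)

lemma integrable_std_normal_id: "integrable std_normal_distribution (\<lambda>t. t)"
  using integrable_std_normal_moment[of 1] by (simp add: integrable_std_normal_distribution)

interpretation std_normal_pair: pair_sigma_finite std_normal_distribution std_normal_distribution ..

context
  fixes u v :: "'a::euclidean_space" and c :: "real \<Rightarrow> real"
  assumes u: "norm u = 1" and v: "norm v = 1" and vu: "v \<bullet> u = 0"
    and c [measurable]: "c \<in> borel_measurable borel"
begin

lemma integral_std_gaussian_orthonormal_pair:
  fixes f :: "real \<times> real \<Rightarrow> real"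
  assumes f: "integrable (std_normal_distribution \<Otimes>\<^sub>M std_normal_distribution) f"
  shows "(\<integral>z. f (v \<bullet> z, u \<bullet> z) \<partial>std_gaussian)
    = (\<integral>t. \<integral>s. f (t, s) \<partial>std_normal_distribution \<partial>std_normal_distribution)"
proof -
  have "(\<integral>z. f (v \<bullet> z, u \<bullet> z) \<partial>std_gaussian)
      = (\<integral>p. f p \<partial>distr std_gaussian (std_normal_distribution \<Otimes>\<^sub>M std_normal_distribution)
          (\<lambda>z. (v \<bullet> z, u \<bullet> z)))"
    using borel_measurable_integrable[OF f] by (intro integral_distr[symmetric]) auto
  also have "\<dots> = (\<integral>t. \<integral>s. f (t, s) \<partial>std_normal_distribution \<partial>std_normal_distribution)"
    unfolding distr_std_gaussian_orthonormal_pair[OF u v vu]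
    by (rule std_normal_pair.integral_fst'[OF f, symmetric])
  finally show ?thesis .
qed

text \<open>At a fixed value \<open>t\<close> of \<open>v \<bullet> z\<close> the region is the
  half-line from \<open>- c t\<close>, of probability \<open>std_normal_cdf (c t)\<close>. The
  weights \<open>1\<close>, \<open>t\<close> and \<open>exp (r * t)\<close> for \<open>G\<close>
  yield the integrals of (A), (C) and the shifted mean.\<close>

lemma integral_std_gaussian_region_fst:
  assumes G: "integrable std_normal_distribution G"
  shows "(\<integral>z. indicator {z. 0 \<le> u \<bullet> z + c (v \<bullet> z)} z * G (v \<bullet> z) \<partial>std_gaussian)
    = (\<integral>t. G t * std_normal_cdf (c t) \<partial>std_normal_distribution)"
proof -
  have [measurable]: "G \<in> borel_measurable borel"
    using borel_measurable_integrable[OF G] by simp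
  define f where "f p = indicator {p. 0 \<le> snd p + c (fst p)} p * G (fst p)" for p :: "real \<times> real"
  have [measurable]: "f \<in> borel_measurable (std_normal_distribution \<Otimes>\<^sub>M std_normal_distribution)"
    unfolding f_def[abs_def] by measurable
  have "integrable (std_normal_distribution \<Otimes>\<^sub>M std_normal_distribution) (\<lambda>p. G (fst p))"
    using G std_normal.prob_space
    by (intro std_normal_pair.Fubini_integrable) (simp_all add: integrable_norm)
  then have f: "integrable (std_normal_distribution \<Otimes>\<^sub>M std_normal_distribution) f"
    by (rule Bochner_Integration.integrable_bound)
      (auto simp: f_def split: split_indicator)
  have "(\<integral>z. indicator {z. 0 \<le> u \<bullet> z + c (v \<bullet> z)} z * G (v \<bullet> z) \<partial>std_gaussian)
      = (\<integral>z. f (v \<bullet> z, u \<bullet> z) \<partial>std_gaussian)"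
    by (intro Bochner_Integration.integral_cong) (auto simp: f_def split: split_indicator)
  also have "\<dots> = (\<integral>t. \<integral>s. f (t, s) \<partial>std_normal_distribution \<partial>std_normal_distribution)"
    by (rule integral_std_gaussian_orthonormal_pair[OF f])
  also have "\<dots> = (\<integral>t. \<integral>s. indicator {- c t..} s * G t \<partial>std_normal_distribution \<partial>std_normal_distribution)"
    by (intro Bochner_Integration.integral_cong) (auto simp: f_def split: split_indicator)
  finally show ?thesis
    by (simp add: std_normal_cdf_eq_measure_atLeast mult.commute)
qed

text \<open>The integral of \<open>s\<close> over the same half-line is
  \<open>std_normal_density (c t)\<close>, which is how the integral in (B) arises.\<close>

lemma integral_std_gaussian_region_snd:
  "(\<integral>z. indicator {z. 0 \<le> u \<bullet> z + c (v \<bullet> z)} z * (u \<bullet> z) \<partial>std_gaussian)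
    = (\<integral>t. std_normal_density (c t) \<partial>std_normal_distribution)"
proof -
  define f where "f p = indicator {p. 0 \<le> snd p + c (fst p)} p * snd p" for p :: "real \<times> real"
  have [measurable]: "f \<in> borel_measurable (std_normal_distribution \<Otimes>\<^sub>M std_normal_distribution)"
    unfolding f_def[abs_def] by measurable
  have "integrable (std_normal_distribution \<Otimes>\<^sub>M std_normal_distribution) snd"
    using integrable_std_normal_id by (intro std_normal_pair.Fubini_integrable) simp_all
  then have f: "integrable (std_normal_distribution \<Otimes>\<^sub>M std_normal_distribution) f"
    by (rule Bochner_Integration.integrable_bound)
      (auto simp: f_def split: split_indicator)
  have "(\<integral>z. indicator {z. 0 \<le> u \<bullet> z + c (v \<bullet> z)} z * (u \<bullet> z) \<partial>std_gaussian)
      = (\<integral>z. f (v \<bullet> z, u \<bullet> z) \<partial>std_gaussian)"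
    by (intro Bochner_Integration.integral_cong) (auto simp: f_def split: split_indicator)
  also have "\<dots> = (\<integral>t. \<integral>s. f (t, s) \<partial>std_normal_distribution \<partial>std_normal_distribution)"
    by (rule integral_std_gaussian_orthonormal_pair[OF f])
  also have "\<dots> = (\<integral>t. \<integral>s. indicator {- c t..} s * s \<partial>std_normal_distribution \<partial>std_normal_distribution)"
    by (intro Bochner_Integration.integral_cong) (auto simp: f_def split: split_indicator)
  finally show ?thesis
    by (simp add: integral_std_normal_id_atLeast)
qed

text \<open>Every slice of the graph is a single point, hence null. This settles the degenerate case
  \<open>c2 = 0\<close> of the Neyman-Pearson argument.\<close>

lemma AE_std_gaussian_graph: "AE z in std_gaussian. u \<bullet> z + c (v \<bullet> z) \<noteq> 0"
proof -
  let ?N = std_normal_distribution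
  have "AE t in ?N. AE s in ?N. s + c t \<noteq> 0"
  proof (rule AE_I2)
    fix t
    show "AE s in ?N. s + c t \<noteq> 0"
      by (subst AE_density) (use AE_lborel_singleton[of "- c t"] in auto)
  qed
  moreover have "{p \<in> space (?N \<Otimes>\<^sub>M ?N). snd p + c (fst p) \<noteq> 0} \<in> sets (?N \<Otimes>\<^sub>M ?N)"
    by measurable
  ultimately have "AE p in ?N \<Otimes>\<^sub>M ?N. snd p + c (fst p) \<noteq> 0"
    by (intro std_normal_pair.AE_pair_measure) auto
  then have "AE p in distr std_gaussian (?N \<Otimes>\<^sub>M ?N) (\<lambda>z. (v \<bullet> z, u \<bullet> z)). snd p + c (fst p) \<noteq> 0"
    by (simp only: distr_std_gaussian_orthonormal_pair[OF u v vu])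
  then show ?thesis
    using AE_distrD[of "\<lambda>z. (v \<bullet> z, u \<bullet> z)" std_gaussian "?N \<Otimes>\<^sub>M ?N"
        "\<lambda>p. snd p + c (fst p) \<noteq> 0"] by simp
qed

end

section \<open>Generalized Neyman-Pearson comparison\<close>

lemma std_gaussian_real: "std_gaussian = std_normal_distribution"
  by (simp add: std_gaussian_def std_gaussian_density_def std_normal_density_def)

text \<open>The generalized Neyman-Pearson argument: \<open>H\<close> and the indicator of the region
  \<open>{z. 0 \<le> u \<bullet> z + c (v \<bullet> z)}\<close> differ by a function whose sign is opposite to that of
  \<open>u \<bullet> z + c (v \<bullet> z)\<close>. If \<open>c2 = 0\<close>, the hypotheses force equality almost everywhere.\<close>

lemma std_gaussian_neyman_pearson:
  fixes u v :: "'a::euclidean_space" and H :: "'a \<Rightarrow> real"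
    and c :: "real \<Rightarrow> real" and c0 c1 c2 r :: real
  assumes u: "norm u = 1" and v: "norm v = 1" and vu: "v \<bullet> u = 0"
    and H [measurable]: "H \<in> borel_measurable borel" and H01: "\<And>z. 0 \<le> H z" "\<And>z. H z \<le> 1"
    and c_eq: "\<And>t. c t = c0 + c1 * t + c2 * exp (r * t)"
    and m0: "c0 * (\<integral>t. std_normal_cdf (c t) \<partial>std_normal_distribution)
      \<le> c0 * (\<integral>z. H z \<partial>std_gaussian)"
    and m1: "c1 * (\<integral>t. t * std_normal_cdf (c t) \<partial>std_normal_distribution)
      \<le> c1 * (\<integral>z. H z * (v \<bullet> z) \<partial>std_gaussian)"
    and m2: "(\<integral>t. std_normal_density (c t) \<partial>std_normal_distribution)
      \<le> (\<integral>z. H z * (u \<bullet> z) \<partial>std_gaussian)"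
    and c2: "c2 \<le> 0"
  shows "(\<integral>t. exp (r * t) * std_normal_cdf (c t) \<partial>std_normal_distribution)
    \<le> (\<integral>z. H z * exp (r * (v \<bullet> z)) \<partial>std_gaussian)"
proof -
  have c [measurable]: "c \<in> borel_measurable borel" unfolding c_eq[abs_def] by measurable
  define I :: "'a \<Rightarrow> real" where "I = indicator {z. 0 \<le> u \<bullet> z + c (v \<bullet> z)}"
  have [measurable]: "I \<in> borel_measurable borel" unfolding I_def by measurable
  have I01: "0 \<le> I z" "I z \<le> 1" for z by (simp_all add: I_def indicator_def)
  have mult: "integrable std_gaussian (\<lambda>z. F z * f z)"
    if "integrable std_gaussian f" "F \<in> borel_measurable borel" "\<And>z. 0 \<le> F z" "\<And>z. F z \<le> 1"
    for F f :: "'a \<Rightarrow> real"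
    using integrable_scaleR_bounded[of std_gaussian f F] that by simp
  have int_exp: "integrable std_gaussian (\<lambda>z::'a. exp (r * (v \<bullet> z)))"
    using integrable_std_gaussian_exp[of "r *\<^sub>R v"] by simp
  note base = integrable_std_gaussian_inner[of u] integrable_std_gaussian_inner[of v] int_exp
  note intH = base[THEN mult[OF _ H H01]] and intI = base[THEN mult[OF _ \<open>I \<in> _\<close> I01]]
  have int0: "integrable std_gaussian H" "integrable std_gaussian I"
    using mult[of "\<lambda>_. 1" H] mult[of "\<lambda>_. 1" I] H01 I01 by simp_all
  have exp1: "integrable std_normal_distribution (\<lambda>t. exp (r * t))"
    using integrable_std_gaussian_exp[of r] by (simp add: std_gaussian_real)
  have I0: "(\<integral>z. I z \<partial>std_gaussian) = (\<integral>t. std_normal_cdf (c t) \<partial>std_normal_distribution)"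
    using integral_std_gaussian_region_fst[OF u v vu c, of "\<lambda>_. 1"] by (simp add: I_def)
  have I1: "(\<integral>z. I z * (v \<bullet> z) \<partial>std_gaussian)
      = (\<integral>t. t * std_normal_cdf (c t) \<partial>std_normal_distribution)"
    using integral_std_gaussian_region_fst[OF u v vu c integrable_std_normal_id]
    by (simp add: I_def)
  have I2: "(\<integral>z. I z * (u \<bullet> z) \<partial>std_gaussian)
      = (\<integral>t. std_normal_density (c t) \<partial>std_normal_distribution)"
    using integral_std_gaussian_region_snd[OF u v vu c] by (simp add: I_def)
  have I3: "(\<integral>z. I z * exp (r * (v \<bullet> z)) \<partial>std_gaussian)
      = (\<integral>t. exp (r * t) * std_normal_cdf (c t) \<partial>std_normal_distribution)"
    using integral_std_gaussian_region_fst[OF u v vu c exp1] by (simp add: I_def)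
  \<comment> \<open>Where the second factor is nonnegative, \<open>I\<close> is 1 and dominates
    \<open>H\<close>; elsewhere \<open>I\<close> is 0. So the factors never have strictly opposite
    signs.\<close>
  define g where "g z = (I z - H z) * (u \<bullet> z + c (v \<bullet> z))" for z
  have g_nonneg: "0 \<le> g z" for z
    using H01[of z] by (auto simp: g_def I_def indicator_def intro!: mult_nonneg_nonpos)
  have g_eq: "g = (\<lambda>z. (I z * (u \<bullet> z) - H z * (u \<bullet> z)) + (c0 * (I z - H z)
      + (c1 * (I z * (v \<bullet> z) - H z * (v \<bullet> z))
      + c2 * (I z * exp (r * (v \<bullet> z)) - H z * exp (r * (v \<bullet> z))))))"
    by (auto simp: g_def c_eq algebra_simps)
  have g_int: "integrable std_gaussian g"
    unfolding g_eq
    by (intro Bochner_Integration.integrable_add Bochner_Integration.integrable_diff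
        integrable_mult_right intH intI int0)
  \<comment> \<open>Expanding \<open>c\<close> shows \<open>1\<close>, \<open>c0\<close>,
    \<open>c1\<close> and \<open>c2\<close> acting as multipliers. The moment hypotheses make the
    first three contributions to the integral of \<open>g\<close> nonpositive, leaving
    \<open>0 \<le> c2 * \<Delta>\<close>.\<close>
  define \<Delta> where "\<Delta> = (\<integral>z. I z * exp (r * (v \<bullet> z)) \<partial>std_gaussian)
    - (\<integral>z. H z * exp (r * (v \<bullet> z)) \<partial>std_gaussian)"
  have "(\<integral>z. g z \<partial>std_gaussian)
      = ((\<integral>z. I z * (u \<bullet> z) \<partial>std_gaussian) - (\<integral>z. H z * (u \<bullet> z) \<partial>std_gaussian))
      + (c0 * ((\<integral>z. I z \<partial>std_gaussian) - (\<integral>z. H z \<partial>std_gaussian))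
      + (c1 * ((\<integral>z. I z * (v \<bullet> z) \<partial>std_gaussian) - (\<integral>z. H z * (v \<bullet> z) \<partial>std_gaussian))
      + c2 * \<Delta>))"
    unfolding g_eq \<Delta>_def using intH intI int0
    by (simp add: Bochner_Integration.integrable_add Bochner_Integration.integrable_diff
        integrable_mult_right)
  then have g_le: "(\<integral>z. g z \<partial>std_gaussian) \<le> c2 * \<Delta>"
    using m0 m1 m2 by (simp add: I0 I1 I2 right_diff_distrib)
  moreover have g_ge: "0 \<le> (\<integral>z. g z \<partial>std_gaussian)"
    using g_nonneg by simp
  ultimately have "0 \<le> c2 * \<Delta>" by simp
  have "\<Delta> \<le> 0"
  proof (cases "c2 = 0")
    case False
    then show ?thesis using c2 \<open>0 \<le> c2 * \<Delta>\<close> by (simp add: zero_le_mult_iff)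
  next
    case True
    then have "(\<integral>z. g z \<partial>std_gaussian) = 0" using g_le g_ge by simp
    then have "AE z in std_gaussian. g z = 0"
      using integral_nonneg_eq_0_iff_AE[OF g_int] g_nonneg by simp
    then have "AE z in std_gaussian. I z = H z"
      using AE_std_gaussian_graph[OF u v vu c] by eventually_elim (simp add: g_def)
    then have "(\<integral>z. I z * exp (r * (v \<bullet> z)) \<partial>std_gaussian)
        = (\<integral>z. H z * exp (r * (v \<bullet> z)) \<partial>std_gaussian)"
      by (intro integral_cong_AE) auto
    then show ?thesis by (simp add: \<Delta>_def)
  qed
  then show ?thesis by (simp add: \<Delta>_def I3)
qed

subsection \<open>Gaussian smoothing of classifiers\<close>

lemma gaussian_density_scaled:
  fixes z :: "real^'d::finite"
  assumes "\<sigma> > 0"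
  shows "gaussian_density \<sigma> (\<sigma> *\<^sub>R z) = std_gaussian_density z / \<sigma> ^ CARD('d)"
  using assms
  by (simp add: gaussian_density_def std_gaussian_density_def power_mult_distrib real_sqrt_mult)

lemma borel_measurable_gaussian_density [measurable]:
  "gaussian_density \<sigma> \<in> borel_measurable borel"
  unfolding gaussian_density_def[abs_def] by measurable

lemma lborel_integral_affine:
  fixes f :: "'a::euclidean_space \<Rightarrow> real"
  assumes [measurable]: "f \<in> borel_measurable borel" and "s > 0"
  shows "(\<integral>z. f z \<partial>lborel) = s ^ DIM('a) * (\<integral>z. f (x + s *\<^sub>R z) \<partial>lborel)"
  using \<open>s > 0\<close>
  by (subst lborel_affine[of s x]) (simp_all add: integral_density integral_distr)

lemma AE_lborel_translate:
  fixes x :: "'a::euclidean_space"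
  assumes "AE z in lborel. P z"
  shows "AE z in lborel. P (x + z)"
proof -
  obtain N where N: "N \<in> null_sets lborel" "{z. \<not> P z} \<subseteq> N"
    using assms by (auto simp: eventually_ae_filter)
  then have "{z. z - (- x) \<in> N} \<in> null_sets lborel"
    by (intro null_sets_translation)
  moreover have "{z \<in> space lborel. \<not> P (x + z)} \<subseteq> {z. z - (- x) \<in> N}"
    using N(2) by (auto simp: add.commute)
  ultimately show ?thesis by (rule AE_I')
qed

lemma integrable_gaussian_density:
  assumes "\<sigma> > 0"
  shows "integrable lborel (gaussian_density \<sigma> :: real^'d::finite \<Rightarrow> real)"
proof -
  have "integrable std_gaussian (\<lambda>z::real^'d. 1 :: real)" by simp
  then have "integrable lborel (std_gaussian_density :: real^'d \<Rightarrow> real)"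
    unfolding std_gaussian_def by (subst (asm) integrable_density) simp_all
  then show ?thesis
    using assms by (subst lborel_affine[of \<sigma> 0])
      (simp_all add: integrable_density integrable_distr_eq gaussian_density_scaled)
qed

text \<open>Placing the shift on the density instead of on \<open>f\<close> lets a single
  \<open>H\<close>, independent of \<open>w\<close>, represent the component near \<open>x\<close>;
  value, gradient and shifted value all become integrals of this \<open>H\<close>.\<close>

lemma smooth_gaussian_component:
  fixes f :: "real^'d::finite \<Rightarrow> real^'y::finite"
  assumes f: "f \<in> classifiers" and \<sigma>: "\<sigma> > 0"
  obtains H where "H \<in> borel_measurable borel" "\<And>z. 0 \<le> H z" "\<And>z. H z \<le> 1"
    "\<And>w. smooth f (gaussian_density \<sigma>) (x + \<sigma> *\<^sub>R w) $ k
      = (\<integral>z. H z * exp (w \<bullet> z - (norm w)\<^sup>2 / 2) \<partial>std_gaussian)"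
proof -
  have f_meas: "f \<in> borel_measurable lebesgue" and f_simplex: "\<And>z. f z \<in> prob_simplex"
    using f by (auto simp: classifiers_def)
  have f01: "0 \<le> f z $ j" "f z $ j \<le> 1" for z j
  proof -
    show "0 \<le> f z $ j" using f_simplex[of z] by (simp add: prob_simplex_def)
    have "f z $ j \<le> (\<Sum>i\<in>UNIV. f z $ i)"
      using f_simplex[of z] by (intro member_le_sum) (auto simp: prob_simplex_def)
    then show "f z $ j \<le> 1" using f_simplex[of z] by (simp add: prob_simplex_def)
  qed
  have f_meas_k: "(\<lambda>z. f z $ k) \<in> borel_measurable lebesgue"
    using f_meas borel_measurable_continuous_onI[OF continuous_on_component[OF continuous_on_id]]
    by (rule measurable_compose)
  then obtain F where F: "F \<in> borel_measurable lborel" "AE z in lborel. f z $ k = F z"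
    using completion_ex_borel_measurable_real by blast
  \<comment> \<open>The Borel version \<open>F\<close> agrees with the component only almost
    everywhere; clamping restores the bounds 0 and 1 at every point.\<close>
  define G where "G z = min 1 (max 0 (F z))" for z
  have G_meas [measurable]: "G \<in> borel_measurable borel"
    using F(1) unfolding G_def by measurable
  have G01: "0 \<le> G z" "G z \<le> 1" for z by (simp_all add: G_def)
  have G_AE: "AE z in lborel. f z $ k = G z"
    using F(2) by eventually_elim (metis G_def f01 max_absorb2 min_absorb2)
  have smooth_eq: "smooth f (gaussian_density \<sigma>) u $ k
      = (LINT z|lborel. gaussian_density \<sigma> z * G (u + z))" for u
  proof -
    have translate: "(\<lambda>z::real^'d. u + z) \<in> lebesgue \<rightarrow>\<^sub>M lebesgue"
      using lebesgue_affine_measurable[of "\<lambda>_. 1" u] by (simp add: euclidean_representation)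
    have density_meas: "gaussian_density \<sigma> \<in> borel_measurable (lebesgue :: (real^'d) measure)"
      by (intro measurable_completion) simp
    \<comment> \<open>Integrability of the vector-valued integrand allows taking the component
      inside the integral.\<close>
    have int: "integrable lebesgue (\<lambda>z. gaussian_density \<sigma> z *\<^sub>R f (u + z))"
    proof (rule Bochner_Integration.integrable_bound)
      show "integrable lebesgue (gaussian_density \<sigma> :: real^'d \<Rightarrow> real)"
        using integrable_gaussian_density[OF \<sigma>] by (simp add: integrable_completion)
      show "(\<lambda>z. gaussian_density \<sigma> z *\<^sub>R f (u + z)) \<in> borel_measurable lebesgue"
        by (intro borel_measurable_scaleR density_meas measurable_compose[OF translate f_meas])
      have "norm (f z) \<le> 1" for z
        using norm_le_l1_cart[of "f z"] f01 f_simplex[of z] by (simp add: prob_simplex_def)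
      then show "AE z in lebesgue. norm (gaussian_density \<sigma> z *\<^sub>R f (u + z))
          \<le> norm (gaussian_density \<sigma> z)"
        by (intro AE_I2) (simp add: mult_left_le)
    qed
    have "smooth f (gaussian_density \<sigma>) u $ k
        = (LINT z|lebesgue. gaussian_density \<sigma> z * f (u + z) $ k)"
      unfolding smooth_def using integral_bounded_linear[OF bounded_linear_vec_nth[of k] int] by simp
    also have "\<dots> = (LINT z|lebesgue. gaussian_density \<sigma> z * G (u + z))"
    proof (rule integral_cong_AE)
      show "(\<lambda>z. gaussian_density \<sigma> z * f (u + z) $ k) \<in> borel_measurable lebesgue"
        by (intro borel_measurable_times density_meas measurable_compose[OF translate f_meas_k])
      show "(\<lambda>z. gaussian_density \<sigma> z * G (u + z)) \<in> borel_measurable lebesgue"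
        by (intro measurable_completion) simp
      show "AE z in lebesgue. gaussian_density \<sigma> z * f (u + z) $ k = gaussian_density \<sigma> z * G (u + z)"
        using AE_completion[OF AE_lborel_translate[OF G_AE, of u]] by eventually_elim simp
    qed
    also have "\<dots> = (LINT z|lborel. gaussian_density \<sigma> z * G (u + z))"
      by (rule integral_completion) simp
    finally show ?thesis .
  qed
  define H where "H z = G (x + \<sigma> *\<^sub>R z)" for z
  have [measurable]: "H \<in> borel_measurable borel" unfolding H_def by measurable
  have "smooth f (gaussian_density \<sigma>) (x + \<sigma> *\<^sub>R w) $ k
      = (\<integral>z. H z * exp (w \<bullet> z - (norm w)\<^sup>2 / 2) \<partial>std_gaussian)" for w
  proof -
    \<comment> \<open>The substitution cancels \<open>\<sigma> *\<^sub>R w\<close> in the argument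
      of \<open>G\<close> and moves the shift to the density; the Jacobian
      \<open>\<sigma> ^ CARD('d)\<close> then cancels against the normalisation.\<close>
    have "smooth f (gaussian_density \<sigma>) (x + \<sigma> *\<^sub>R w) $ k
        = \<sigma> ^ CARD('d) * (LINT z|lborel. gaussian_density \<sigma> (- (\<sigma> *\<^sub>R w) + \<sigma> *\<^sub>R z)
            * G ((x + \<sigma> *\<^sub>R w) + (- (\<sigma> *\<^sub>R w) + \<sigma> *\<^sub>R z)))"
      unfolding smooth_eq by (subst lborel_integral_affine[OF _ \<sigma>, where x="- (\<sigma> *\<^sub>R w)"]) simp_all
    also have "\<dots> = (LINT z|lborel. std_gaussian_density (z - w) * H z)"
      by (subst integral_mult_right_zero[symmetric], intro Bochner_Integration.integral_cong refl)
        (use gaussian_density_scaled[OF \<sigma>, of "_ - w"] \<sigma> in \<open>simp add: H_def scaleR_diff_right\<close>)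
    also have "\<dots> = (\<integral>z. H z * exp (w \<bullet> z - (norm w)\<^sup>2 / 2) \<partial>std_gaussian)"
      unfolding std_gaussian_def
      by (subst integral_density) (auto simp: std_gaussian_density_diff H_def mult_ac)
    finally show ?thesis .
  qed
  then show ?thesis
    using that[of H] G01 \<open>H \<in> _\<close> by (metis H_def)
qed

section \<open>Gradients, and the equations as standard normal integrals\<close>

lemma gradient_eqI:
  assumes D: "GDERIV F x :> D"
  shows "gradient F x = D"
  unfolding gradient_def
proof (rule the_equality)
  show "GDERIV F x :> D" by (rule D)
  fix D' assume "GDERIV F x :> D'"
  then have "(\<lambda>h. h \<bullet> D') = (\<lambda>h. h \<bullet> D)"
    using has_derivative_unique D unfolding gderiv_def by blast
  then have "\<forall>h. h \<bullet> D' = h \<bullet> D" by (simp add: fun_eq_iff)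
  then show "D' = D" by (simp only: vector_eq_ldot)
qed

text \<open>Completing the square turns the shift by \<open>r\<close> into the weight
  \<open>exp (r * t)\<close>, the form in which the Neyman-Pearson comparison is stated.\<close>

lemma bound_value_eq:
  assumes [measurable]: "c \<in> borel_measurable borel"
  shows "bound_value r c = exp (- r\<^sup>2 / 2)
    * (\<integral>t. exp (r * t) * std_normal_cdf (c t) \<partial>std_normal_distribution)"
proof -
  have shift: "std_normal_density (t - r) = exp (- r\<^sup>2 / 2) * (std_normal_density t * exp (r * t))" for t
  proof -
    have "- (t - r)\<^sup>2 / 2 = - r\<^sup>2 / 2 + (- t\<^sup>2 / 2 + r * t)"
      by (simp add: power2_eq_square field_simps)
    then show ?thesis
      by (simp only: std_normal_density_def exp_add mult_ac)
  qed
  have "bound_value r c = (LBINT t. exp (- r\<^sup>2 / 2)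
      * (std_normal_density t * (exp (r * t) * std_normal_cdf (c t))))"
    unfolding bound_value_def by (simp only: shift mult_ac)
  also have "\<dots> = exp (- r\<^sup>2 / 2)
      * (LBINT t. std_normal_density t * (exp (r * t) * std_normal_cdf (c t)))"
    by (rule integral_mult_right_zero)
  finally show ?thesis
    by (subst integral_std_normal_distribution) simp_all
qed

lemma eq_A_iff:
  assumes "c \<in> borel_measurable borel"
  shows "eq_A c q \<longleftrightarrow> (\<integral>t. std_normal_cdf (c t) \<partial>std_normal_distribution) = q"
  using assms by (simp add: eq_A_def integral_std_normal_distribution)

lemma eq_B_iff:
  assumes "c \<in> borel_measurable borel"
  shows "eq_B c m2 \<longleftrightarrow> (\<integral>t. std_normal_density (c t) \<partial>std_normal_distribution) = m2"
  using assms by (simp add: eq_B_def integral_std_normal_distribution)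

lemma eq_C_iff:
  assumes "c \<in> borel_measurable borel"
  shows "eq_C c m1 \<longleftrightarrow> (\<integral>t. t * std_normal_cdf (c t) \<partial>std_normal_distribution) = m1"
  using assms by (simp add: eq_C_def integral_std_normal_distribution mult_ac)

text \<open>The normal density is strictly positive, so its mean cannot vanish. Combined with the
  upper bound on \<open>m2\<close>, this makes the gradient component orthogonal to \<open>v\<close>
  nonzero, so that it can be normalised.\<close>

lemma eq_B_pos:
  assumes [measurable]: "c \<in> borel_measurable borel" and "eq_B c m2"
  shows "m2 > 0"
proof -
  have int: "integrable std_normal_distribution (\<lambda>t. std_normal_density (c t))"
  proof (rule std_normal.integrable_const_bound)
    show "AE t in std_normal_distribution. norm (std_normal_density (c t)) \<le> 1 / sqrt (2 * pi)"
      by (intro AE_I2) (simp add: std_normal_density_def divide_right_mono)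
  qed simp
  have "(\<integral>t. std_normal_density (c t) \<partial>std_normal_distribution) \<noteq> 0"
  proof
    assume "(\<integral>t. std_normal_density (c t) \<partial>std_normal_distribution) = 0"
    then have "AE t in std_normal_distribution. std_normal_density (c t) = 0"
      using integral_nonneg_eq_0_iff_AE[OF int] by simp
    moreover have "std_normal_density (c t) \<noteq> 0" for t
      by (simp add: std_normal_density_def)
    ultimately have "AE t in std_normal_distribution. False" by simp
    then show False using std_normal.AE_False by blast
  qed
  moreover have "0 \<le> (\<integral>t. std_normal_density (c t) \<partial>std_normal_distribution)"
    by (intro integral_nonneg_AE AE_I2) simp
  ultimately have "0 < (\<integral>t. std_normal_density (c t) \<partial>std_normal_distribution)"
    by (metis order_le_less)
  then show ?thesis
    using \<open>eq_B c m2\<close> eq_B_iff[OF assms(1)] by metis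
qed

text \<open>The moment conditions are multiplied by their coefficients so that one statement covers
  a nonnegative coefficient, an exact moment, and, with \<open>c1 = 0\<close>, the reduced system
  without (C).\<close>

lemma smooth_gaussian_lower_bound:
  fixes h :: "real^'d::finite \<Rightarrow> real^'y::finite" and x v :: "real^'d"
    and \<sigma> r q m1 m2 c0 c1 c2 :: real
  defines "c \<equiv> \<lambda>t. c0 + c1 * t + c2 * exp (r * t)"
  assumes \<sigma>: "\<sigma> > 0" and h: "h \<in> smoothed_classifiers (gaussian_density \<sigma>)" and v: "norm v = 1"
    and y0: "h x $ k = y0" and y1: "gradient (\<lambda>u. h u $ k) x = y1"
    and A: "eq_A c q" "c0 * q \<le> c0 * y0"
    and B: "eq_B c m2" "m2 \<le> \<sigma> * norm (y1 - (v \<bullet> y1) *\<^sub>R v)"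
    and C: "c1 \<noteq> 0 \<Longrightarrow> eq_C c m1" "c1 * m1 \<le> c1 * (\<sigma> * (v \<bullet> y1))"
    and c2: "c2 \<le> 0"
  shows "bound_value r c \<le> h (x + (\<sigma> * r) *\<^sub>R v) $ k"
proof -
  have c: "c \<in> borel_measurable borel" unfolding c_def by measurable
  obtain f where f: "f \<in> classifiers" "h = smooth f (gaussian_density \<sigma>)"
    using h by (auto simp: smoothed_classifiers_def)
  obtain H where H [measurable]: "H \<in> borel_measurable borel"
    and H01: "\<And>z. 0 \<le> H z" "\<And>z. H z \<le> 1"
    and h_eq: "\<And>w. h (x + \<sigma> *\<^sub>R w) $ k
      = (\<integral>z. H z * exp (w \<bullet> z - (norm w)\<^sup>2 / 2) \<partial>std_gaussian)"
    using smooth_gaussian_component[OF f(1) \<sigma>, where x=x and k=k]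
    unfolding f(2) by blast
  have H_abs: "\<bar>H z\<bar> \<le> 1" for z using H01[of z] by simp
  define D where "D = (\<integral>z. H z *\<^sub>R z \<partial>std_gaussian)"
  have int: "integrable std_gaussian (\<lambda>z. H z *\<^sub>R z)"
    by (rule integrable_scaleR_bounded[OF integrable_std_gaussian_id _ H_abs]) simp
  have inner_D: "w \<bullet> D = (\<integral>z. H z * (w \<bullet> z) \<partial>std_gaussian)" for w
    unfolding D_def using int by (simp flip: integral_inner_right)
  have "GDERIV (\<lambda>u. h u $ k) x :> D /\<^sub>R \<sigma>"
  proof -
    define P where "P w = (\<integral>z. H z * exp (w \<bullet> z - (norm w)\<^sup>2 / 2) \<partial>std_gaussian)" for w
    have "GDERIV P 0 :> D"
      using GDERIV_std_gaussian_translate[OF H H_abs] unfolding P_def[abs_def] D_def .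
    \<comment> \<open>Writing 0 as the image of \<open>x\<close> under the rescaling
      \<open>(u - x) /\<^sub>R \<sigma>\<close> matches the form of the chain rule, which
      contributes the factor \<open>1 / \<sigma>\<close>.\<close>
    then have P: "(P has_derivative (\<lambda>w. w \<bullet> D)) (at ((x - x) /\<^sub>R \<sigma>))"
      by (simp add: gderiv_def)
    have "((\<lambda>u. (u - x) /\<^sub>R \<sigma>) has_derivative (\<lambda>w. w /\<^sub>R \<sigma>)) (at x)"
      by (auto intro!: derivative_eq_intros)
    from has_derivative_compose[OF this P]
    have "((\<lambda>u. P ((u - x) /\<^sub>R \<sigma>)) has_derivative (\<lambda>w. w \<bullet> (D /\<^sub>R \<sigma>))) (at x)"
      by simp
    moreover have "h u $ k = P ((u - x) /\<^sub>R \<sigma>)" for u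
      using h_eq[of "(u - x) /\<^sub>R \<sigma>"] \<sigma> by (simp add: P_def)
    ultimately show ?thesis
      by (simp add: gderiv_def)
  qed
  from gradient_eqI[OF this] have "D /\<^sub>R \<sigma> = y1"
    by (simp only: y1)
  then have D: "D = \<sigma> *\<^sub>R y1"
    using \<sigma> by auto
  define w where "w = y1 - (v \<bullet> y1) *\<^sub>R v"
  have "\<sigma> * norm w > 0"
    using eq_B_pos[OF c B(1)] B(2) by (simp add: w_def)
  then have "w \<noteq> 0" by auto
  define u where "u = w /\<^sub>R norm w"
  have u: "norm u = 1" using \<open>w \<noteq> 0\<close> by (simp add: u_def)
  have "v \<bullet> v = 1" using v by (simp add: dot_square_norm)
  then have "v \<bullet> w = 0" by (simp add: w_def inner_diff_right)
  then have vu: "v \<bullet> u = 0" by (simp add: u_def)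
  \<comment> \<open>Only the component of \<open>y1\<close> orthogonal to \<open>v\<close> is seen
    by \<open>w\<close>. After normalisation, the moment of \<open>H\<close> along \<open>u\<close>
    is \<open>\<sigma> * norm w\<close>, the quantity bounding \<open>m2\<close>.\<close>
  have "w \<bullet> y1 = w \<bullet> w"
    using \<open>v \<bullet> w = 0\<close> by (simp add: w_def inner_diff_right inner_commute)
  then have "u \<bullet> y1 = norm w"
    using \<open>w \<noteq> 0\<close> by (simp add: u_def dot_square_norm power2_eq_square)
  have H_int: "(\<integral>z. H z \<partial>std_gaussian) = y0"
    using h_eq[of 0] y0 by simp
  have "(\<integral>t. exp (r * t) * std_normal_cdf (c t) \<partial>std_normal_distribution)
      \<le> (\<integral>z. H z * exp (r * (v \<bullet> z)) \<partial>std_gaussian)"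
  proof (rule std_gaussian_neyman_pearson[OF u v vu H H01 _ _ _ _ c2])
    show "c t = c0 + c1 * t + c2 * exp (r * t)" for t by (simp add: c_def)
    show "c0 * (\<integral>t. std_normal_cdf (c t) \<partial>std_normal_distribution) \<le> c0 * (\<integral>z. H z \<partial>std_gaussian)"
      using A by (simp add: H_int eq_A_iff[OF c])
    show "c1 * (\<integral>t. t * std_normal_cdf (c t) \<partial>std_normal_distribution)
        \<le> c1 * (\<integral>z. H z * (v \<bullet> z) \<partial>std_gaussian)"
      using C by (cases "c1 = 0") (simp_all add: eq_C_iff[OF c] inner_D[symmetric] D)
    show "(\<integral>t. std_normal_density (c t) \<partial>std_normal_distribution)
        \<le> (\<integral>z. H z * (u \<bullet> z) \<partial>std_gaussian)"
      using B \<open>u \<bullet> y1 = norm w\<close> by (simp add: eq_B_iff[OF c] inner_D[symmetric] D w_def)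
  qed
  \<comment> \<open>Since \<open>v\<close> is a unit vector, the factor
    \<open>exp (- r\<^sup>2 / 2)\<close> is also the normalisation of the translation weight for
    \<open>w = r *\<^sub>R v\<close>.\<close>
  then have "bound_value r c \<le> exp (- r\<^sup>2 / 2) * (\<integral>z. H z * exp (r * (v \<bullet> z)) \<partial>std_gaussian)"
    by (simp add: bound_value_eq[OF c])
  also have "\<dots> = (\<integral>z. exp (- r\<^sup>2 / 2) * (H z * exp (r * (v \<bullet> z))) \<partial>std_gaussian)"
    by (rule integral_mult_right_zero[symmetric])
  also have "\<dots> = (\<integral>z. H z * exp ((r *\<^sub>R v) \<bullet> z - (norm (r *\<^sub>R v))\<^sup>2 / 2) \<partial>std_gaussian)"
  proof -
    have "(r *\<^sub>R v) \<bullet> z - (norm (r *\<^sub>R v))\<^sup>2 / 2 = - r\<^sup>2 / 2 + r * (v \<bullet> z)" for z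
      by (simp add: v)
    then show ?thesis
      by (simp only: exp_add mult_ac)
  qed
  also have "\<dots> = h (x + (\<sigma> * r) *\<^sub>R v) $ k"
    using h_eq[of "r *\<^sub>R v"] by simp
  finally show ?thesis .
qed

section \<open>Passage to the infimum over all competitors\<close>

lemma lower_prob_ge_bound_value:
  fixes f :: "real^'d::finite \<Rightarrow> real^'y::finite" and x v y1 :: "real^'d"
    and \<sigma> r y0 q m1 m2 c0 c1 c2 :: real
  defines "c \<equiv> \<lambda>t. c0 + c1 * t + c2 * exp (r * t)"
  assumes \<sigma>: "\<sigma> > 0" and f: "f \<in> classifiers"
    and y0: "y0 = smooth f (gaussian_density \<sigma>) x $ k"
    and y1: "y1 = gradient (\<lambda>u. smooth f (gaussian_density \<sigma>) u $ k) x"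
    and v: "norm v = 1"
    and A: "eq_A c q" "c0 * q \<le> c0 * y0"
    and B: "eq_B c m2" "m2 \<le> \<sigma> * norm (y1 - (v \<bullet> y1) *\<^sub>R v)"
    and C: "c1 \<noteq> 0 \<Longrightarrow> eq_C c m1" "c1 * m1 \<le> c1 * (\<sigma> * (v \<bullet> y1))"
    and c2: "c2 \<le> 0"
  shows "bound_value r c \<le> lower_prob (gaussian_density \<sigma>) k x y0 y1 (x + (\<sigma> * r) *\<^sub>R v)"
  unfolding lower_prob_def
proof (rule cInf_greatest)
  \<comment> \<open>The smoothing of \<open>f\<close> is itself a competitor, so the infimum is over
    a nonempty set.\<close>
  have "smooth f (gaussian_density \<sigma>) \<in> smoothed_classifiers (gaussian_density \<sigma>)"
    using f by (auto simp: smoothed_classifiers_def)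
  then show "{h (x + (\<sigma> * r) *\<^sub>R v) $ k | h. h \<in> smoothed_classifiers (gaussian_density \<sigma>) \<and>
      h x $ k = y0 \<and> gradient (\<lambda>u. h u $ k) x = y1} \<noteq> {}"
    using y0 y1 by blast
  fix p assume "p \<in> {h (x + (\<sigma> * r) *\<^sub>R v) $ k | h. h \<in> smoothed_classifiers (gaussian_density \<sigma>) \<and>
      h x $ k = y0 \<and> gradient (\<lambda>u. h u $ k) x = y1}"
  then obtain h where "p = h (x + (\<sigma> * r) *\<^sub>R v) $ k"
      "h \<in> smoothed_classifiers (gaussian_density \<sigma>)"
      "h x $ k = y0" "gradient (\<lambda>u. h u $ k) x = y1"
    by blast
  then show "bound_value r c \<le> p"
    using smooth_gaussian_lower_bound[OF \<sigma> _ v, of h x k y0 y1 c0 c1 c2 r q m2 m1] A B C c2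
    unfolding c_def by blast
qed

theorem theorem3:
  fixes f g :: "real^'d::finite \<Rightarrow> real^'y::finite"
    and k :: 'y
    and x v y1 :: "real^'d"
    and \<sigma> r y0 q m1 m2 c0 c1 c2 :: real
  assumes "\<sigma> > 0"
    and "f \<in> classifiers"
    and "g = smooth f (gaussian_density \<sigma>)"
    and "y0 = g x $ k"
    and "y1 = gradient (\<lambda>u. g u $ k) x"
    and "norm v = 1"
    and "r > 0"
    and "q \<le> y0"
    and "m1 \<le> \<sigma> * (v \<bullet> y1)"
    and "m2 \<le> \<sigma> * norm (y1 - (v \<bullet> y1) *\<^sub>R v)"
    and "eq_A (\<lambda>t. c0 + c1 * t + c2 * exp (r * t)) q"
    and "eq_B (\<lambda>t. c0 + c1 * t + c2 * exp (r * t)) m2"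
    and "eq_C (\<lambda>t. c0 + c1 * t + c2 * exp (r * t)) m1"
    and "c2 \<le> 0"
  shows "(c1 \<ge> 0 \<longrightarrow> (c0 \<ge> 0 \<or> q = y0) \<longrightarrow>
           lower_prob (gaussian_density \<sigma>) k x y0 y1 (x + (\<sigma> * r) *\<^sub>R v)
             \<ge> bound_value r (\<lambda>t. c0 + c1 * t + c2 * exp (r * t)))
       \<and> (c1 < 0 \<longrightarrow>
           (\<forall>a0 a2. eq_A (\<lambda>t. a0 + a2 * exp (r * t)) q \<longrightarrow>
                    eq_B (\<lambda>t. a0 + a2 * exp (r * t)) m2 \<longrightarrow>
                    a2 \<le> 0 \<longrightarrow> (a0 \<ge> 0 \<or> q = y0) \<longrightarrow>
              lower_prob (gaussian_density \<sigma>) k x y0 y1 (x + (\<sigma> * r) *\<^sub>R v)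
                \<ge> bound_value r (\<lambda>t. a0 + a2 * exp (r * t))))"
proof (intro conjI impI allI)
  have y0: "y0 = smooth f (gaussian_density \<sigma>) x $ k"
    and y1: "y1 = gradient (\<lambda>u. smooth f (gaussian_density \<sigma>) u $ k) x"
    using assms(3,4,5) by simp_all
  note bound = lower_prob_ge_bound_value[OF \<open>\<sigma> > 0\<close> \<open>f \<in> classifiers\<close> y0 y1 \<open>norm v = 1\<close>]
  have nonneg: "a * q \<le> a * y0" if "a \<ge> 0 \<or> q = y0" for a
    using that \<open>q \<le> y0\<close> by (auto intro: mult_left_mono)
  show "lower_prob (gaussian_density \<sigma>) k x y0 y1 (x + (\<sigma> * r) *\<^sub>R v)
      \<ge> bound_value r (\<lambda>t. c0 + c1 * t + c2 * exp (r * t))"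
    if "c1 \<ge> 0" "c0 \<ge> 0 \<or> q = y0"
    using bound[of c0 c1 c2 r q m2 m1] assms nonneg[OF that(2)] that
    by (simp add: mult_left_mono)
  \<comment> \<open>The reduced system is the case of multiplier 0 for (C), where both conditions
    involving \<open>m1\<close> hold trivially.\<close>
  show "lower_prob (gaussian_density \<sigma>) k x y0 y1 (x + (\<sigma> * r) *\<^sub>R v)
      \<ge> bound_value r (\<lambda>t. a0 + a2 * exp (r * t))"
    if "eq_A (\<lambda>t. a0 + a2 * exp (r * t)) q" "eq_B (\<lambda>t. a0 + a2 * exp (r * t)) m2"
      "a2 \<le> 0" "a0 \<ge> 0 \<or> q = y0" for a0 a2
    using bound[of a0 0 a2 r q m2 m1] assms(10) nonneg[OF that(4)] that by simp
qed

end
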